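(* Let $P$ be a finite partially ordered set with $n$ elements and let $x,y\in P$ with $x\not\ge y$. For any $k\in\{1,\ldots,n-1\}$, the following are equivalent: (a) $N_k=0$. (b) $|P_{<x}|+|P_{>y}|>n-k-1$ or $|P_{x<\cdot<y}|>k-1$.
   Context: A linear extension of $P$ is a bijection $f:P\to\{1,\ldots,n\}$ such that $f(z)<f(z')$ whenever $z<z'$. For $k=1,\ldots,n-1$, $N_k$ denotes the number of linear extensions $f$ of $P$ with $f(y)-f(x)=k$. Notation: $P_{<x}=\{\omega\in P:\omega<x\}$, $P_{>y}=\{\omega\in P:\omega>y\}$, $P_{x<\cdot<y}=\{\omega\in P:x<\omega<y\}$. *)

theory Defs
  imports Main "HOL-Library.FuncSet"
begin

(* A poset is a carrier P with a reflexive order relation r in the sense of partial_order_on;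
   (a, b) \<in> r reads a \<le> b. *)

definition strictly_below :: "'a rel \<Rightarrow> 'a \<Rightarrow> 'a \<Rightarrow> bool" where
  "strictly_below r a b \<longleftrightarrow> (a, b) \<in> r \<and> a \<noteq> b"

definition elems_below :: "'a set \<Rightarrow> 'a rel \<Rightarrow> 'a \<Rightarrow> 'a set" where
  "elems_below P r x = {w \<in> P. strictly_below r w x}"

definition elems_above :: "'a set \<Rightarrow> 'a rel \<Rightarrow> 'a \<Rightarrow> 'a set" where
  "elems_above P r y = {w \<in> P. strictly_below r y w}"

definition elems_between :: "'a set \<Rightarrow> 'a rel \<Rightarrow> 'a \<Rightarrow> 'a \<Rightarrow> 'a set" where
  "elems_between P r x y = {w \<in> P. strictly_below r x w \<and> strictly_below r w y}"

(* The extensional function space makes f undefined outside P, so that each linear extension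
   is represented by exactly one function and the set of them is finite for finite P. *)

definition linear_extensions :: "'a set \<Rightarrow> 'a rel \<Rightarrow> ('a \<Rightarrow> nat) set" where
  "linear_extensions P r =
     {f \<in> P \<rightarrow>\<^sub>E {1..card P}. bij_betw f P {1..card P} \<and>
        (\<forall>z\<in>P. \<forall>z'\<in>P. strictly_below r z z' \<longrightarrow> f z < f z')}"

(* The difference of positions is taken in the integers. *)

definition num_ext_gap :: "'a set \<Rightarrow> 'a rel \<Rightarrow> 'a \<Rightarrow> 'a \<Rightarrow> nat \<Rightarrow> nat" where
  "num_ext_gap P r x y k = card {f \<in> linear_extensions P r. int (f y) - int (f x) = int k}"

end

theory Submission
  imports Defs
begin

text \<open>
  The elements below \<open>x\<close> occupy positions before \<open>x\<close>, those above \<open>y\<close> positions after \<open>y\<close>, and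
  those between \<open>x\<close> and \<open>y\<close> positions strictly between the two; counting positions shows that
  each inequality in (b) excludes a gap of \<open>k\<close>.

  For the converse, a linear extension in which \<open>y\<close> stands \<open>k\<close> places after \<open>x\<close> is recorded by two
  of its initial segments: the set \<open>A\<close> of elements before \<open>x\<close> and the set \<open>D\<close> of elements before
  \<open>y\<close>. The order enters only through the requirement that \<open>A\<close>, \<open>A \<union> {x}\<close>, \<open>D\<close> and \<open>D \<union> {y}\<close> be
  down-sets, since an enumeration of a down-set always continues to the next larger one
  (\<open>linear_extension_extend\<close>); the gap is \<open>|D| - |A|\<close>. The widest choice is \<open>A = P\<^bsub><x\<^esub>\<close> and
  \<open>D = {z. \<not> y \<le> z}\<close>, with gap \<open>n - 1 - |P\<^bsub><x\<^esub>| - |P\<^bsub>>y\<^esub>|\<close>. As long as \<open>D - A - {x}\<close> contains an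
  element that is not between \<open>x\<close> and \<open>y\<close>, a suitably extremal such element can be moved into
  \<open>A\<close> or out of \<open>D\<close>, which narrows the gap by exactly one (\<open>gap_cut_narrow\<close>). Hence every gap
  from the widest one down to \<open>|P\<^bsub>x<\<cdot><y\<^esub>| + 1\<close> occurs.
\<close>

section \<open>Extending linear extensions from down-sets\<close>

definition down_closed :: "'a set \<Rightarrow> 'a rel \<Rightarrow> 'a set \<Rightarrow> bool" where
  "down_closed P r A \<longleftrightarrow> A \<subseteq> P \<and> (\<forall>a\<in>A. \<forall>b\<in>P. (b, a) \<in> r \<longrightarrow> b \<in> A)"

lemma down_closedD: "down_closed P r A \<Longrightarrow> a \<in> A \<Longrightarrow> b \<in> P \<Longrightarrow> (b, a) \<in> r \<Longrightarrow> b \<in> A"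
  by (auto simp: down_closed_def)

lemma down_closed_subset: "down_closed P r A \<Longrightarrow> A \<subseteq> P"
  by (simp add: down_closed_def)

lemma strictly_below_transp: "trans r \<Longrightarrow> antisym r \<Longrightarrow> transp_on S (strictly_below r)"
  unfolding transp_on_def strictly_below_def by (blast dest: transD antisymD)

lemma strictly_below_asymp: "antisym r \<Longrightarrow> asymp_on S (strictly_below r)"
  unfolding asymp_on_def strictly_below_def by (blast dest: antisymD)

lemma ex_minimal:
  assumes "finite S" "S \<noteq> {}" "trans r" "antisym r"
  obtains m where "m \<in> S" "\<And>z. z \<in> S \<Longrightarrow> (z, m) \<in> r \<Longrightarrow> z = m"
  using Finite_Set.bex_min_element[OF assms(1) strictly_below_asymp[OF assms(4)]
      strictly_below_transp[OF assms(3,4)] assms(2)]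
  by (auto simp: strictly_below_def)

lemma ex_maximal:
  assumes "finite S" "S \<noteq> {}" "trans r" "antisym r"
  obtains m where "m \<in> S" "\<And>z. z \<in> S \<Longrightarrow> (m, z) \<in> r \<Longrightarrow> z = m"
  using Finite_Set.bex_max_element[OF assms(1) strictly_below_asymp[OF assms(4)]
      strictly_below_transp[OF assms(3,4)] assms(2)]
  by (auto simp: strictly_below_def)

lemma linear_extension_insert:
  assumes f: "f \<in> linear_extensions A r" and fin: "finite A" and m: "m \<notin> A"
    and top: "\<And>a. a \<in> A \<Longrightarrow> (m, a) \<notin> r"
  shows "f(m := card A + 1) \<in> linear_extensions (insert m A) r"
proof -
  let ?g = "f(m := card A + 1)"
  have fE: "f \<in> A \<rightarrow>\<^sub>E {1..card A}" and fb: "bij_betw f A {1..card A}"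
    and fm: "\<And>z z'. z \<in> A \<Longrightarrow> z' \<in> A \<Longrightarrow> strictly_below r z z' \<Longrightarrow> f z < f z'"
    using f by (auto simp: linear_extensions_def)
  have c: "card (insert m A) = card A + 1" using fin m by simp
  have "bij_betw ?g (A \<union> {m}) ({1..card A} \<union> {card A + 1})"
    by (rule bij_betw_combine) (use fb m in \<open>auto simp: bij_betw_def inj_on_def\<close>)
  moreover have "{1..card A} \<union> {card A + 1} = {1..card A + 1}" by auto
  ultimately have gb: "bij_betw ?g (insert m A) {1..card (insert m A)}"
    using c by simp
  have gE: "?g \<in> insert m A \<rightarrow>\<^sub>E {1..card (insert m A)}"
  proof (rule PiE_I)
    show "?g z \<in> {1..card (insert m A)}" if "z \<in> insert m A" for z
      using bij_betwE[OF gb] that by blast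
    show "?g z = undefined" if "z \<notin> insert m A" for z
      using that PiE_arb[OF fE, of z] by simp
  qed
  have "?g z < ?g z'" if z: "z \<in> insert m A" "z' \<in> insert m A" "strictly_below r z z'" for z z'
  proof -
    have zA: "z \<in> A" using z top by (auto simp: strictly_below_def)
    then have "f z \<le> card A" using PiE_mem[OF fE] by force
    then show ?thesis using z zA m fm[of z z'] by (cases "z' = m") auto
  qed
  then show ?thesis using gb gE unfolding linear_extensions_def by blast
qed

text \<open>
  A minimal element of \<open>B - A\<close> has all its predecessors in \<open>A\<close>, so it may take the next free
  position. The values on \<open>A\<close> never change, which is what fixes the position of an element
  once it has been placed.
\<close>

lemma linear_extension_extend:
  assumes po: "trans r" "antisym r" and B: "finite B"
    and A: "down_closed B r A" and f: "f \<in> linear_extensions A r"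
  shows "\<exists>g \<in> linear_extensions B r. \<forall>a\<in>A. g a = f a"
  using A f
proof (induction "card (B - A)" arbitrary: A f)
  case 0
  then have "A = B" using B by (auto simp: down_closed_def)
  then show ?case using 0 by auto
next
  case (Suc j)
  then have "B - A \<noteq> {}" by (metis card.empty nat.distinct(1))
  then obtain m where m: "m \<in> B - A" and mmin: "\<And>z. z \<in> B - A \<Longrightarrow> (z, m) \<in> r \<Longrightarrow> z = m"
    using ex_minimal[of "B - A" r] B po by auto
  have fA: "finite A" using Suc.prems(1) B by (auto simp: down_closed_def dest: finite_subset)
  let ?f = "f(m := card A + 1)"
  have "?f \<in> linear_extensions (insert m A) r"
    using linear_extension_insert[OF Suc.prems(2) fA] m Suc.prems(1)
    by (auto dest: down_closedD)
  moreover have "down_closed B r (insert m A)"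
    using Suc.prems(1) m mmin by (auto simp: down_closed_def)
  moreover have "j = card (B - insert m A)"
    using Suc.hyps(2) m B by (metis Diff_insert card_Diff_singleton diff_Suc_1)
  ultimately obtain g where g: "g \<in> linear_extensions B r" "\<forall>a\<in>insert m A. g a = ?f a"
    using Suc.hyps(1) by blast
  have "g a = f a" if "a \<in> A" for a
  proof -
    have "g a = ?f a" using g(2) that by blast
    then show ?thesis using that m by auto
  qed
  then show ?case using g(1) by blast
qed

section \<open>Pairs of down-sets that realise a gap\<close>

text \<open>
  \<open>A\<close> and \<open>D\<close> are possible sets of predecessors of \<open>x\<close> and of \<open>y\<close> in a linear extension that
  places \<open>x\<close> before \<open>y\<close>.
\<close>

definition gap_cut :: "'a set \<Rightarrow> 'a rel \<Rightarrow> 'a \<Rightarrow> 'a \<Rightarrow> 'a set \<Rightarrow> 'a set \<Rightarrow> bool" where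
  "gap_cut P r x y A D \<longleftrightarrow>
     down_closed P r A \<and> down_closed P r (insert x A) \<and>
     down_closed P r D \<and> down_closed P r (insert y D) \<and>
     insert x A \<subseteq> D \<and> x \<notin> A \<and> y \<notin> D"

lemma down_closed_mono: "down_closed P r A \<Longrightarrow> A \<subseteq> B \<Longrightarrow> B \<subseteq> P \<Longrightarrow> down_closed B r A"
  by (auto simp: down_closed_def)

text \<open>
  Enumerating along the chain \<open>A\<close>, \<open>A \<union> {x}\<close>, \<open>D\<close>, \<open>D \<union> {y}\<close>, \<open>P\<close> puts \<open>x\<close> at position
  \<open>|A| + 1\<close> and \<open>y\<close> at position \<open>|D| + 1\<close>.
\<close>

lemma gap_cut_realised:
  assumes po: "trans r" "antisym r" and P: "finite P" and cut: "gap_cut P r x y A D"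
  shows "\<exists>f \<in> linear_extensions P r. f x = card A + 1 \<and> f y = card D + 1"
proof -
  note cut = cut[unfolded gap_cut_def]
  have sub: "A \<subseteq> P" "D \<subseteq> P" "insert x A \<subseteq> D" "x \<notin> A" "insert y D \<subseteq> P" "y \<notin> D"
    using cut by (auto dest!: down_closed_subset)
  have fin: "finite A" "finite D" using sub P by (auto dest: finite_subset)
  have "(\<lambda>_. undefined) \<in> linear_extensions {} r"
    by (auto simp: linear_extensions_def bij_betw_def)
  moreover have "down_closed A r {}" by (simp add: down_closed_def)
  ultimately obtain f1 where f1: "f1 \<in> linear_extensions A r"
    using linear_extension_extend[OF po fin(1)] by blast
  let ?f2 = "f1(x := card A + 1)"
  have xtop: "(x, a) \<notin> r" if "a \<in> A" for a
    using cut that sub by (auto dest: down_closedD)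
  have f2: "?f2 \<in> linear_extensions (insert x A) r"
    by (rule linear_extension_insert[OF f1 fin(1) sub(4) xtop])
  have "down_closed D r (insert x A)" using cut sub by (blast intro: down_closed_mono)
  then obtain f3 where f3: "f3 \<in> linear_extensions D r" and f3x: "f3 x = card A + 1"
    using linear_extension_extend[OF po fin(2) _ f2] by fastforce
  let ?f4 = "f3(y := card D + 1)"
  have ytop: "(y, a) \<notin> r" if "a \<in> D" for a
    using cut that sub by (auto dest: down_closedD)
  have f4: "?f4 \<in> linear_extensions (insert y D) r"
    by (rule linear_extension_insert[OF f3 fin(2) sub(6) ytop])
  have "down_closed P r (insert y D)" using cut by blast
  then obtain f5 where f5: "f5 \<in> linear_extensions P r" and "\<forall>a\<in>insert y D. f5 a = ?f4 a"
    using linear_extension_extend[OF po P _ f4] by blast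
  then have "f5 x = card A + 1" "f5 y = card D + 1" using f3x sub by auto
  then show ?thesis using f5 by blast
qed

text \<open>
  The set \<open>D - A - {x}\<close> has \<open>j\<close> elements, so some \<open>w\<close> in it fails to lie between
  \<open>x\<close> and \<open>y\<close>. If \<open>w\<close> is not above \<open>x\<close>, then neither is anything below \<open>w\<close>, so a minimal element of this kind has all its predecessors in
  \<open>A\<close> and can join \<open>A\<close>. If \<open>w\<close> is not below \<open>y\<close>, then dually a maximal element of this kind can
  leave \<open>D\<close>.
\<close>

lemma gap_cut_narrow:
  assumes po: "trans r" "antisym r" and P: "finite P" and cut: "gap_cut P r x y A D"
    and gap: "card D = card A + Suc j" and j: "card (elems_between P r x y) < j"
  shows "\<exists>A' D'. gap_cut P r x y A' D' \<and> card D' = card A' + j"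
proof -
  note cut' = cut[unfolded gap_cut_def]
  have sub: "A \<subseteq> P" "D \<subseteq> P" "insert x A \<subseteq> D" "x \<notin> A" "x \<in> P" "y \<in> P" "y \<notin> D"
    using cut' by (auto dest!: down_closed_subset)
  have fin: "finite A" "finite D" using sub P by (auto dest: finite_subset)
  let ?M = "D - insert x A"
  have "card ?M = j"
    using gap sub fin by (simp add: card_Diff_subset)
  then have "\<not> ?M \<subseteq> elems_between P r x y"
    using j P card_mono[of "elems_between P r x y" ?M] by (auto simp: elems_between_def)
  then obtain w where w: "w \<in> ?M" "\<not> (strictly_below r x w \<and> strictly_below r w y)"
    using sub by (auto simp: elems_between_def)
  then have "(x, w) \<notin> r \<or> (w, y) \<notin> r"
    using sub by (auto simp: strictly_below_def)
  then show ?thesis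
  proof
    assume xw: "(x, w) \<notin> r"
    let ?S = "{v \<in> ?M. (x, v) \<notin> r}"
    obtain m where m: "m \<in> ?S" and mmin: "\<And>z. z \<in> ?S \<Longrightarrow> (z, m) \<in> r \<Longrightarrow> z = m"
      using ex_minimal[of ?S r] fin w xw po by auto
    have pred: "b \<in> insert m A" if b: "b \<in> P" "(b, m) \<in> r" for b
    proof (rule ccontr)
      assume nb: "b \<notin> insert m A"
      have "b \<in> D" using b m cut' by (auto dest: down_closedD)
      moreover have "b \<noteq> x" "(x, b) \<notin> r" using b m by (auto dest: transD[OF po(1)])
      ultimately have "b \<in> ?S" using nb by auto
      then show False using mmin b nb by blast
    qed
    have "down_closed P r (insert m A)" "down_closed P r (insert x (insert m A))"
      using cut' pred m sub by (auto simp: down_closed_def)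
    then have "gap_cut P r x y (insert m A) D" using cut' m by (auto simp: gap_cut_def)
    moreover have "card D = card (insert m A) + j" using gap fin m by simp
    ultimately show ?thesis by blast
  next
    assume wy: "(w, y) \<notin> r"
    let ?S = "{v \<in> ?M. (v, y) \<notin> r}"
    obtain m where m: "m \<in> ?S" and mmax: "\<And>z. z \<in> ?S \<Longrightarrow> (m, z) \<in> r \<Longrightarrow> z = m"
      using ex_maximal[of ?S r] fin w wy po by auto
    have succ: "(m, a) \<notin> r" if a: "a \<in> D" "a \<noteq> m" for a
    proof
      assume ma: "(m, a) \<in> r"
      have "a \<notin> insert x A" using cut' m ma sub by (auto dest: down_closedD)
      moreover have "(a, y) \<notin> r" using m ma by (auto dest: transD[OF po(1)])
      ultimately show False using mmax ma a by auto
    qed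
    have dD: "down_closed P r D" and dyD: "down_closed P r (insert y D)"
      using cut' by blast+
    have "b \<in> D - {m}" if "a \<in> D - {m}" "b \<in> P" "(b, a) \<in> r" for a b
      using that down_closedD[OF dD, of a b] succ[of a] by auto
    moreover have "b \<in> insert y (D - {m})" if "b \<in> P" "(b, y) \<in> r" for b
      using that m down_closedD[OF dyD, of y b] by auto
    ultimately have "down_closed P r (D - {m})" "down_closed P r (insert y (D - {m}))"
      using sub unfolding down_closed_def by blast+
    then have "gap_cut P r x y A (D - {m})" using cut' m by (auto simp: gap_cut_def)
    moreover have "card (D - {m}) = card A + j" using gap fin m by simp
    ultimately show ?thesis by blast
  qed
qed

lemma gap_cut_widest:
  assumes P: "finite P" and po: "partial_order_on P r"
    and xy: "x \<in> P" "y \<in> P" "(y, x) \<notin> r"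
  defines "A \<equiv> elems_below P r x" and "D \<equiv> {z \<in> P. (y, z) \<notin> r}"
  shows "gap_cut P r x y A D"
    and "card D + card (elems_above P r y) + 1 = card P"
proof -
  have tr: "trans r" and as: "antisym r" and rf: "\<And>z. z \<in> P \<Longrightarrow> (z, z) \<in> r"
    using po by (auto simp: partial_order_on_def preorder_on_def refl_on_def)
  have "down_closed P r A" "down_closed P r (insert x A)" "down_closed P r D"
    "down_closed P r (insert y D)"
    using xy unfolding down_closed_def A_def D_def elems_below_def strictly_below_def
    by (blast dest: transD[OF tr] antisymD[OF as])+
  then show "gap_cut P r x y A D"
    using rf xy
    by (auto simp: gap_cut_def A_def D_def elems_below_def strictly_below_def dest: transD[OF tr])
  have "P = insert y (D \<union> elems_above P r y)" "y \<notin> D \<union> elems_above P r y"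
    "D \<inter> elems_above P r y = {}"
    using xy rf by (auto simp: D_def elems_above_def strictly_below_def)
  moreover have "finite D" "finite (elems_above P r y)"
    using P by (auto simp: D_def elems_above_def)
  ultimately show "card D + card (elems_above P r y) + 1 = card P"
    by (metis Suc_eq_plus1 card_Un_disjoint card_insert_disjoint finite_UnI)
qed

section \<open>The gaps that occur\<close>

lemma linear_extension_with_gap:
  assumes P: "finite P" and po: "partial_order_on P r"
    and xy: "x \<in> P" "y \<in> P" "(y, x) \<notin> r"
    and up: "card (elems_below P r x) + card (elems_above P r y) + k + 1 \<le> card P"
    and lo: "card (elems_between P r x y) < k"
  shows "\<exists>f \<in> linear_extensions P r. f y = f x + k"
proof -
  have tr: "trans r" and as: "antisym r"
    using po by (auto simp: partial_order_on_def preorder_on_def)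
  let ?A = "elems_below P r x" and ?D = "{z \<in> P. (y, z) \<notin> r}"
  note widest = gap_cut_widest[OF P po xy]
  have "k \<le> card ?D - card ?A" using widest(2) up by linarith
  then have "\<exists>A D. gap_cut P r x y A D \<and> card D = card A + k"
  proof (induction k rule: inc_induct)
    case base
    have "card ?A \<le> card ?D" using widest(2) up by linarith
    then show ?case using widest(1) by (metis le_add_diff_inverse)
  next
    case (step j)
    then obtain A D where AD: "gap_cut P r x y A D" "card D = card A + Suc j" by blast
    show ?case by (rule gap_cut_narrow[OF tr as P AD]) (use lo step.hyps in linarith)
  qed
  then obtain A D where cut: "gap_cut P r x y A D" and "card D = card A + k" by blast
  moreover obtain f where "f \<in> linear_extensions P r" "f x = card A + 1" "f y = card D + 1"
    using gap_cut_realised[OF tr as P cut] by blast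
  ultimately show ?thesis by (intro bexI[of _ f]) auto
qed

lemma linear_extension_gap_bounds:
  assumes P: "finite P" and xy: "x \<in> P" "y \<in> P" "0 < k"
    and f: "f \<in> linear_extensions P r" and gap: "f y = f x + k"
  shows "card (elems_below P r x) + card (elems_above P r y) + k + 1 \<le> card P"
    and "card (elems_between P r x y) < k"
proof -
  have range: "\<And>z. z \<in> P \<Longrightarrow> f z \<in> {1..card P}" and inj: "inj_on f P"
    and mono: "\<And>z z'. z \<in> P \<Longrightarrow> z' \<in> P \<Longrightarrow> strictly_below r z z' \<Longrightarrow> f z < f z'"
    using f by (auto simp: linear_extensions_def bij_betw_def)
  have count: "card S \<le> card I" if "S \<subseteq> P" "finite I" "f ` S \<subseteq> I" for S and I :: "nat set"
    using card_inj_on_le[OF inj_on_subset[OF inj that(1)] that(3,2)] .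
  have "card (elems_below P r x) \<le> card {1..<f x}"
    by (rule count) (use range mono xy in \<open>auto simp: elems_below_def\<close>)
  moreover have "card (elems_above P r y) \<le> card {f y<..card P}"
    by (rule count) (use range mono xy in \<open>auto simp: elems_above_def\<close>)
  moreover have "1 \<le> f x" "f y \<le> card P" using range xy by auto
  ultimately show "card (elems_below P r x) + card (elems_above P r y) + k + 1 \<le> card P"
    using gap by simp
  have "card (elems_between P r x y) \<le> card {f x<..<f y}"
    by (rule count) (use mono xy in \<open>auto simp: elems_between_def\<close>)
  then show "card (elems_between P r x y) < k" using gap xy by simp
qed

lemma num_ext_gap_eq_0_iff:
  assumes "finite P"
  shows "num_ext_gap P r x y k = 0 \<longleftrightarrow> (\<forall>f \<in> linear_extensions P r. f y \<noteq> f x + k)"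
proof -
  have "finite (linear_extensions P r)"
    by (rule finite_subset[OF _ finite_PiE[OF assms, of "\<lambda>_. {1..card P}"]])
       (auto simp: linear_extensions_def)
  moreover have "int (f y) - int (f x) = int k \<longleftrightarrow> f y = f x + k" for f
    by linarith
  ultimately show ?thesis by (auto simp: num_ext_gap_def)
qed

theorem lemma1p2:
  fixes P :: "'a set" and r :: "'a rel" and x y :: 'a and n k :: nat
  assumes "finite P" and "partial_order_on P r" and "card P = n"
    and "x \<in> P" and "y \<in> P" and "(y, x) \<notin> r"
    and "k \<in> {1..n - 1}"
  shows "num_ext_gap P r x y k = 0 \<longleftrightarrow>
    int (card (elems_below P r x)) + int (card (elems_above P r y)) > int n - int k - 1 \<or>
    int (card (elems_between P r x y)) > int k - 1"
proof -
  have k: "0 < k" using assms(7) by simp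
  have "(\<exists>f \<in> linear_extensions P r. f y = f x + k) \<longleftrightarrow>
      card (elems_below P r x) + card (elems_above P r y) + k + 1 \<le> card P \<and>
      card (elems_between P r x y) < k"
    using linear_extension_with_gap[OF assms(1,2,4-6)]
      linear_extension_gap_bounds[OF assms(1,4,5) k] by blast
  then have "num_ext_gap P r x y k = 0 \<longleftrightarrow>
      \<not> (card (elems_below P r x) + card (elems_above P r y) + k + 1 \<le> card P \<and>
         card (elems_between P r x y) < k)"
    using num_ext_gap_eq_0_iff[OF assms(1)] by metis
  then show ?thesis using assms(3) by linarith
qed

end
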